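(* Let $r$ be a curve in $\mathbb{R}^3$ parametrized by arc length $s\in[L_1,L_2]$ with $r''(s)\neq0$ for all $s$, with Frenet frame $\{T,N,B\}$, curvature $\kappa$ and torsion $\tau$. Let $\{T,U,V\}$ be a rotation minimizing frame along $r$ with $$U=\cos\theta\,N+\sin\theta\,B,\qquad V=-\sin\theta\,N+\cos\theta\,B,\qquad \theta'(s)=-\tau(s).$$ Let $g:[L_1,L_2]\to\mathbb{R}$ be a $C^1$ function and $t_0\in\mathbb{R}$. Then the ruled surface $$P(s,t)=r(s)+(t-t_0)\left[g(s)T(s)+\sin\theta(s)\,U(s)+\cos\theta(s)\,V(s)\right]$$ is developable if and only if $\tau(s)=g(s)\kappa(s)$ for all $s$.
   Context: Curves are sufficiently smooth for all derivatives used to exist. For an arc-length curve $r$ with $r''\neq0$: $T=r'$, $N=r''/\|r''\|$, $B=T\times N$, $\kappa=\|r''\|$, and $\tau$ is the torsion, with $T'=\kappa N$, $N'=-\kappa T+\tau B$, $B'=-\tau N$. An orthonormal frame $\{T,U,V\}$ along $r$ is rotation minimizing if $U'(s)$ and $V'(s)$ are parallel to $T(s)$ for all $s$, equivalently $U'\cdot V\equiv0$ and $V'\cdot U\equiv0$. A ruled surface $P(s,t)=r(s)+(t-t_0)d(s)$ is developable if $\det(r'(s),d(s),d'(s))=0$ for all $s$. *)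

theory Defs
  imports "HOL-Analysis.Analysis" "HOL-Analysis.Cross3"
begin

text \<open>
  Curves are functions \<open>real \<Rightarrow> real^3\<close> considered on a parameter interval \<open>S\<close>; only their values
  on \<open>S\<close> matter.  All derivatives are taken within \<open>S\<close>, hence are one-sided at the endpoints.
\<close>

definition deriv_on :: "real set \<Rightarrow> (real \<Rightarrow> real^3) \<Rightarrow> real \<Rightarrow> real^3" where
  "deriv_on S f s = vector_derivative f (at s within S)"

text \<open>The third derivative is what the existence of the torsion requires.\<close>

definition arc_length_curve :: "real set \<Rightarrow> (real \<Rightarrow> real^3) \<Rightarrow> bool" where
  "arc_length_curve S r \<longleftrightarrow>
     r differentiable_on S \<and>
     deriv_on S r differentiable_on S \<and>
     deriv_on S (deriv_on S r) differentiable_on S \<and>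
     (\<forall>s\<in>S. norm (deriv_on S r s) = 1)"

definition tangent :: "real set \<Rightarrow> (real \<Rightarrow> real^3) \<Rightarrow> real \<Rightarrow> real^3" where
  "tangent S r = deriv_on S r"

definition curvature :: "real set \<Rightarrow> (real \<Rightarrow> real^3) \<Rightarrow> real \<Rightarrow> real" where
  "curvature S r s = norm (deriv_on S (deriv_on S r) s)"

definition normal :: "real set \<Rightarrow> (real \<Rightarrow> real^3) \<Rightarrow> real \<Rightarrow> real^3" where
  "normal S r s =
     deriv_on S (deriv_on S r) s /\<^sub>R norm (deriv_on S (deriv_on S r) s)"

definition binormal :: "real set \<Rightarrow> (real \<Rightarrow> real^3) \<Rightarrow> real \<Rightarrow> real^3" where
  "binormal S r s = cross3 (tangent S r s) (normal S r s)"

text \<open>Sign convention: \<open>B' = - \<tau> N\<close>, so that \<open>\<tau>\<close> is the coefficient \<open>- (B' \<bullet> N)\<close>.\<close>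

definition torsion :: "real set \<Rightarrow> (real \<Rightarrow> real^3) \<Rightarrow> real \<Rightarrow> real" where
  "torsion S r s = - (deriv_on S (binormal S r) s \<bullet> normal S r s)"

definition orthonormal_triple :: "real^3 \<Rightarrow> real^3 \<Rightarrow> real^3 \<Rightarrow> bool" where
  "orthonormal_triple x y z \<longleftrightarrow>
     norm x = 1 \<and> norm y = 1 \<and> norm z = 1 \<and> x \<bullet> y = 0 \<and> x \<bullet> z = 0 \<and> y \<bullet> z = 0"

definition rotation_minimizing_frame ::
  "real set \<Rightarrow> (real \<Rightarrow> real^3) \<Rightarrow> (real \<Rightarrow> real^3) \<Rightarrow> (real \<Rightarrow> real^3) \<Rightarrow> bool" where
  "rotation_minimizing_frame S r U V \<longleftrightarrow>
     U differentiable_on S \<and> V differentiable_on S \<and>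
     (\<forall>s\<in>S. orthonormal_triple (tangent S r s) (U s) (V s)) \<and>
     (\<forall>s\<in>S. \<exists>c. deriv_on S U s = c *\<^sub>R tangent S r s) \<and>
     (\<forall>s\<in>S. \<exists>c. deriv_on S V s = c *\<^sub>R tangent S r s)"

definition ruled_surface_with ::
  "real set \<Rightarrow> (real \<Rightarrow> real \<Rightarrow> real^3) \<Rightarrow> (real \<Rightarrow> real^3) \<Rightarrow> (real \<Rightarrow> real^3) \<Rightarrow> real \<Rightarrow> bool"
where
  "ruled_surface_with S P r d t0 \<longleftrightarrow>
     r differentiable_on S \<and> d differentiable_on S \<and>
     (\<forall>s\<in>S. \<forall>t. P s t = r s + (t - t0) *\<^sub>R d s)"

text \<open>
  The existential quantifier only recovers the data \<open>(r, d, t0)\<close> from the map \<open>P\<close>.  The map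
  determines \<open>d\<close> on \<open>S\<close>, and a change of \<open>t0\<close> replaces \<open>r\<close> by \<open>r + c d\<close> for a constant \<open>c\<close>,
  which leaves the determinant unchanged; so the choice of data is immaterial.
\<close>

definition developable :: "real set \<Rightarrow> (real \<Rightarrow> real \<Rightarrow> real^3) \<Rightarrow> bool" where
  "developable S P \<longleftrightarrow>
     (\<exists>r d t0. ruled_surface_with S P r d t0 \<and>
        (\<forall>s\<in>S. det (vector [deriv_on S r s, d s, deriv_on S d s] :: real^3^3) = 0))"

end

theory Submission
  imports Defs
begin

text \<open>
  The rotation by \<open>\<theta>\<close> that turns \<open>{N, B}\<close> into \<open>{U, V}\<close> is undone by the coefficients of the
  ruling, \<open>sin \<theta> U + cos \<theta> V = B\<close>, so the ruling is just \<open>d = g T + B\<close>.  Its derivative is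
  \<open>d' = g' T + g \<kappa> N + B'\<close>, and since \<open>T \<times> d = T \<times> B = - N\<close>, the developability determinant is
  \<open>det (T, d, d') = (T \<times> d) \<bullet> d' = - (g \<kappa> + B' \<bullet> N) = \<tau> - g \<kappa>\<close>,
  because \<open>\<tau>\<close> is by definition \<open>- B' \<bullet> N\<close>.  This vanishes exactly when \<open>\<tau> = g \<kappa>\<close>.

  The predicate \<open>developable\<close> speaks of the map \<open>P\<close> and quantifies over its presentations as a ruled
  surface.  The lemma \<open>developable_iff_det\<close> shows that the determinant condition is the same for
  every presentation, so that it may be tested on the given one; \<open>ruling_determinant\<close> is the
  computation above.
\<close>

text \<open>At an isolated point the derivative within \<open>S\<close> is arbitrary; a nondegenerate interval has none,
  which is what makes derivatives within it computable by the usual rules.\<close>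

lemma deriv_on_eqI:
  assumes "a < b" "s \<in> {a..b}" "(f has_vector_derivative f') (at s within {a..b})"
  shows "deriv_on {a..b} f s = f'"
  unfolding deriv_on_def using assms by (rule vector_derivative_within_closed_interval)

lemma has_vector_derivative_deriv_on:
  assumes "f differentiable_on S" "s \<in> S"
  shows "(f has_vector_derivative deriv_on S f s) (at s within S)"
  using assms unfolding deriv_on_def differentiable_on_def
  by (simp flip: vector_derivative_works)

lemma deriv_on_cong:
  assumes ab: "a < b" "s \<in> {a..b}" and f: "f differentiable_on {a..b}"
    and eq: "\<And>x. x \<in> {a..b} \<Longrightarrow> h x = f x"
  shows "deriv_on {a..b} h s = deriv_on {a..b} f s"
  by (rule deriv_on_eqI[OF ab has_vector_derivative_transform[OF ab(2) eq]])
    (use has_vector_derivative_deriv_on[OF f ab(2)] in auto)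

lemma differentiable_on_cross3:
  assumes "f differentiable_on S" "h differentiable_on S"
  shows "(\<lambda>s. cross3 (f s) (h s)) differentiable_on S"
proof -
  interpret bounded_bilinear cross3
    using bilinear_cross bilinear_conv_bounded_bilinear by blast
  show ?thesis
    using assms FDERIV unfolding differentiable_on_def differentiable_def by blast
qed

text \<open>Sliding the base curve along the rulings by a constant amount \<open>c\<close> changes its velocity by a
  multiple of the last row.\<close>

lemma det_shear_first_row:
  fixes a d v :: "real^3"
  shows "det (vector [a + c *\<^sub>R v, d, v] :: real^3^3) = det (vector [a, d, v])"
  by (simp add: dot_cross_det[symmetric] inner_add_left dot_cross_self)

text \<open>Two presentations of the same map have the same ruling, as it is the velocity in \<open>t\<close>, and base
  curves that differ by a constant multiple of it.\<close>

lemma developable_iff_det: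
  assumes ab: "a < b" and r: "r differentiable_on {a..b}" and d: "d differentiable_on {a..b}"
  shows "developable {a..b} (\<lambda>s t. r s + (t - t0) *\<^sub>R d s) \<longleftrightarrow>
    (\<forall>s\<in>{a..b}. det (vector [deriv_on {a..b} r s, d s, deriv_on {a..b} d s] :: real^3^3) = 0)"
    (is "?dev \<longleftrightarrow> ?det")
proof
  assume ?det
  with r d show ?dev
    unfolding developable_def ruled_surface_with_def by blast
next
  assume ?dev
  then obtain q e t1 where q: "q differentiable_on {a..b}" and e: "e differentiable_on {a..b}"
    and P: "\<And>s t. s \<in> {a..b} \<Longrightarrow> r s + (t - t0) *\<^sub>R d s = q s + (t - t1) *\<^sub>R e s"
    and det: "\<And>s. s \<in> {a..b} \<Longrightarrow>
      det (vector [deriv_on {a..b} q s, e s, deriv_on {a..b} e s] :: real^3^3) = 0"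
    unfolding developable_def ruled_surface_with_def by blast
  define c where "c = t1 - t0"
  have q_eq: "q s = r s + c *\<^sub>R d s" if "s \<in> {a..b}" for s
    using P[OF that, of t1] by (simp add: c_def)
  have e_eq: "e s = d s" if "s \<in> {a..b}" for s
    using P[OF that, of "t1 + 1"] q_eq[OF that] by (simp add: c_def algebra_simps)
  show ?det
  proof
    fix s assume s: "s \<in> {a..b}"
    have "((\<lambda>x. r x + c *\<^sub>R d x) has_vector_derivative
        deriv_on {a..b} r s + c *\<^sub>R deriv_on {a..b} d s) (at s within {a..b})"
      using has_vector_derivative_deriv_on[OF r s] has_vector_derivative_deriv_on[OF d s]
      by (auto intro!: derivative_eq_intros)
    from deriv_on_eqI[OF ab s has_vector_derivative_transform[OF s q_eq this]]
    have q': "deriv_on {a..b} q s = deriv_on {a..b} r s + c *\<^sub>R deriv_on {a..b} d s" .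
    have e': "deriv_on {a..b} e s = deriv_on {a..b} d s"
      using ab s d e_eq by (rule deriv_on_cong)
    show "det (vector [deriv_on {a..b} r s, d s, deriv_on {a..b} d s] :: real^3^3) = 0"
      using det[OF s] unfolding q' e' e_eq[OF s] det_shear_first_row .
  qed
qed

text \<open>The vector \<open>w\<close> stands for \<open>B'\<close>: only its \<open>N\<close>-component contributes, because the first two rows
  span the plane of \<open>T\<close> and \<open>B = T \<times> N\<close>, whose normal is \<open>N\<close>.\<close>

lemma ruling_determinant:
  fixes T N w :: "real^3"
  assumes "T \<bullet> T = 1" "N \<bullet> N = 1" "T \<bullet> N = 0"
  shows "det (vector [T, g *\<^sub>R T + cross3 T N, h *\<^sub>R T + k *\<^sub>R N + w] :: real^3^3) = - k - w \<bullet> N"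
proof -
  have "cross3 T (g *\<^sub>R T + cross3 T N) = - N"
    using assms by (simp add: cross_add_right cross_mult_right Lagrange)
  moreover have "det (vector [T, g *\<^sub>R T + cross3 T N, h *\<^sub>R T + k *\<^sub>R N + w] :: real^3^3)
      = cross3 T (g *\<^sub>R T + cross3 T N) \<bullet> (h *\<^sub>R T + k *\<^sub>R N + w)"
    by (metis cross_triple dot_cross_det inner_commute)
  ultimately show ?thesis
    using assms by (simp add: inner_add_right inner_commute)
qed

lemma normal_dot_self:
  assumes "deriv_on S (deriv_on S r) s \<noteq> 0"
  shows "normal S r s \<bullet> normal S r s = 1"
  using assms by (simp add: normal_def dot_square_norm power2_eq_square)

lemma deriv_tangent:
  assumes "deriv_on S (deriv_on S r) s \<noteq> 0"
  shows "deriv_on S (tangent S r) s = curvature S r s *\<^sub>R normal S r s"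
  using assms by (simp add: normal_def tangent_def curvature_def)

text \<open>Differentiating \<open>T \<bullet> T = 1\<close> gives \<open>T \<bullet> T' = 0\<close>.\<close>

lemma tangent_orthogonal_normal:
  assumes ab: "a < b" "s \<in> {a..b}" and r: "arc_length_curve {a..b} r"
  shows "tangent {a..b} r s \<bullet> normal {a..b} r s = 0"
proof -
  let ?T = "deriv_on {a..b} r" and ?K = "deriv_on {a..b} (deriv_on {a..b} r)"
  have T: "(?T has_vector_derivative ?K s) (at s within {a..b})"
    using r ab(2) by (intro has_vector_derivative_deriv_on) (auto simp: arc_length_curve_def)
  have "((\<lambda>x. ?T x \<bullet> ?T x) has_vector_derivative ?T s \<bullet> ?K s + ?K s \<bullet> ?T s) (at s within {a..b})"
    by (rule bounded_bilinear.has_vector_derivative[OF bounded_bilinear_inner T T])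
  moreover have "((\<lambda>x. ?T x \<bullet> ?T x) has_vector_derivative 0) (at s within {a..b})"
    using r by (intro has_vector_derivative_transform[OF ab(2) _ has_vector_derivative_const[of 1]])
      (simp add: arc_length_curve_def dot_square_norm)
  ultimately have "?T s \<bullet> ?K s + ?K s \<bullet> ?T s = 0"
    using vector_derivative_unique_within_closed_interval[OF ab(1), of s] ab(2) by force
  then show ?thesis
    by (simp add: tangent_def normal_def inner_commute)
qed

lemma differentiable_on_binormal:
  assumes "arc_length_curve S r" and "\<And>s. s \<in> S \<Longrightarrow> deriv_on S (deriv_on S r) s \<noteq> 0"
  shows "binormal S r differentiable_on S"
proof -
  let ?K = "deriv_on S (deriv_on S r)"
  have K: "?K differentiable_on S" and T: "tangent S r differentiable_on S"
    using assms(1) by (auto simp: arc_length_curve_def tangent_def)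
  have "(\<lambda>s. norm (?K s)) differentiable_on S"
    using K by (rule differentiable_on_compose) (use assms(2) in \<open>auto intro: differentiable_on_norm\<close>)
  then have "(\<lambda>s. inverse (norm (?K s)) *\<^sub>R ?K s) differentiable_on S"
    using K assms(2) by (intro differentiable_on_scaleR differentiable_on_inverse) auto
  then have "normal S r differentiable_on S"
    unfolding normal_def[abs_def] .
  with T show ?thesis
    unfolding binormal_def[abs_def] by (rule differentiable_on_cross3)
qed

theorem corollary4p2:
  fixes r U V :: "real \<Rightarrow> real^3" and \<theta> g g' :: "real \<Rightarrow> real" and L1 L2 t0 :: real
  assumes "L1 < L2"
    and "arc_length_curve {L1..L2} r"
    and "\<And>s. s \<in> {L1..L2} \<Longrightarrow> deriv_on {L1..L2} (deriv_on {L1..L2} r) s \<noteq> 0"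
    and "rotation_minimizing_frame {L1..L2} r U V"
    and "\<And>s. s \<in> {L1..L2} \<Longrightarrow>
           U s = cos (\<theta> s) *\<^sub>R normal {L1..L2} r s + sin (\<theta> s) *\<^sub>R binormal {L1..L2} r s"
    and "\<And>s. s \<in> {L1..L2} \<Longrightarrow>
           V s = - sin (\<theta> s) *\<^sub>R normal {L1..L2} r s + cos (\<theta> s) *\<^sub>R binormal {L1..L2} r s"
    and "\<And>s. s \<in> {L1..L2} \<Longrightarrow>
           (\<theta> has_real_derivative - torsion {L1..L2} r s) (at s within {L1..L2})"
    and "\<And>s. s \<in> {L1..L2} \<Longrightarrow> (g has_real_derivative g' s) (at s within {L1..L2})"
    and "continuous_on {L1..L2} g'"
  shows "developable {L1..L2}
           (\<lambda>s t. r s + (t - t0) *\<^sub>R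
              (g s *\<^sub>R tangent {L1..L2} r s + sin (\<theta> s) *\<^sub>R U s + cos (\<theta> s) *\<^sub>R V s))
         \<longleftrightarrow> (\<forall>s\<in>{L1..L2}. torsion {L1..L2} r s = g s * curvature {L1..L2} r s)"
proof -
  let ?I = "{L1..L2}"
  let ?T = "tangent ?I r" and ?N = "normal ?I r" and ?B = "binormal ?I r"
  let ?d = "\<lambda>s. g s *\<^sub>R ?T s + sin (\<theta> s) *\<^sub>R U s + cos (\<theta> s) *\<^sub>R V s"
  have r: "r differentiable_on ?I" and T: "?T differentiable_on ?I"
    and unit: "\<And>s. s \<in> ?I \<Longrightarrow> ?T s \<bullet> ?T s = 1"
    using assms(2) by (auto simp: arc_length_curve_def tangent_def dot_square_norm)
  have B: "?B differentiable_on ?I"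
    using assms(2,3) by (rule differentiable_on_binormal)
  have d_eq: "?d s = g s *\<^sub>R ?T s + ?B s" if s: "s \<in> ?I" for s
  proof -
    have "sin (\<theta> s) *\<^sub>R U s + cos (\<theta> s) *\<^sub>R V s
        = (cos (\<theta> s) * cos (\<theta> s)) *\<^sub>R ?B s + (sin (\<theta> s) * sin (\<theta> s)) *\<^sub>R ?B s"
      unfolding assms(5,6)[OF s] by (simp add: algebra_simps)
    also have "\<dots> = ?B s"
      by (simp add: sin_cos_squared_add3 flip: scaleR_left_distrib)
    finally have "sin (\<theta> s) *\<^sub>R U s + cos (\<theta> s) *\<^sub>R V s = ?B s" .
    then show ?thesis by (simp add: add.assoc)
  qed
  have d': "(?d has_vector_derivative
      g' s *\<^sub>R ?T s + (g s * curvature ?I r s) *\<^sub>R ?N s + deriv_on ?I ?B s) (at s within ?I)"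
    if s: "s \<in> ?I" for s
  proof (rule has_vector_derivative_transform[OF s d_eq])
    have "(?T has_vector_derivative curvature ?I r s *\<^sub>R ?N s) (at s within ?I)"
      using has_vector_derivative_deriv_on[OF T s] deriv_tangent[OF assms(3)[OF s]] by simp
    then have "((\<lambda>x. g x *\<^sub>R ?T x) has_vector_derivative
        g s *\<^sub>R curvature ?I r s *\<^sub>R ?N s + g' s *\<^sub>R ?T s) (at s within ?I)"
      using assms(8)[OF s] by (intro has_vector_derivative_scaleR)
    from has_vector_derivative_add[OF this has_vector_derivative_deriv_on[OF B s]]
    show "((\<lambda>x. g x *\<^sub>R ?T x + ?B x) has_vector_derivative
        g' s *\<^sub>R ?T s + (g s * curvature ?I r s) *\<^sub>R ?N s + deriv_on ?I ?B s) (at s within ?I)"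
      by (simp add: add_ac)
  qed
  have d: "?d differentiable_on ?I"
    unfolding differentiable_on_def using d' differentiableI_vector by blast
  have det: "det (vector [deriv_on ?I r s, ?d s, deriv_on ?I ?d s] :: real^3^3)
      = torsion ?I r s - g s * curvature ?I r s" if s: "s \<in> ?I" for s
  proof -
    have "deriv_on ?I ?d s
        = g' s *\<^sub>R ?T s + (g s * curvature ?I r s) *\<^sub>R ?N s + deriv_on ?I ?B s"
      by (rule deriv_on_eqI[OF assms(1) s d'[OF s]])
    moreover have "?d s = g s *\<^sub>R ?T s + cross3 (?T s) (?N s)"
      using d_eq[OF s] by (simp add: binormal_def)
    moreover have "deriv_on ?I r s = ?T s"
      by (simp add: tangent_def)
    ultimately show ?thesis
      by (simp only: torsion_def ruling_determinant[OF unit[OF s] normal_dot_self[OF assms(3)[OF s]]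
          tangent_orthogonal_normal[OF assms(1) s assms(2)]])
  qed
  show ?thesis
    unfolding developable_iff_det[OF assms(1) r d] using det by simp
qed

end
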